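(* Let $K$ be a field of characteristic $0$ and let $[n]=\{1,\ldots,n\}=A\sqcup B$ with $A,B$ nonempty and disjoint. If $f$ and $g$ are nonzero multilinear Lie elements of $\mathrm{Nov}\langle X\rangle$, $X=\{x_1,\ldots,x_n\}$, where $f$ is multilinear in the variables $x_i$, $i\in A$, and $g$ is multilinear in the variables $x_i$, $i\in B$, then $f\circ g$ is not a Lie element.
   Context: A Novikov algebra over $K$ is a (nonassociative) algebra $(N,\circ)$ satisfying $(a\circ b)\circ c-a\circ(b\circ c)=(b\circ a)\circ c-b\circ(a\circ c)$ and $(a\circ b)\circ c=(a\circ c)\circ b$. Its commutator $[a,b]=a\circ b-b\circ a$ satisfies the Jacobi identity; the resulting Lie algebra is denoted $N^{(-)}$. Let $X=\{x_1,\ldots,x_n\}$ and let $K\{X\}=K[x_i^{(r)}\mid 1\le i\le n,\ r\ge 0]$ be the free commutative differential algebra, with $x_i=x_i^{(0)}$ and derivation $D$ given by $D(x_i^{(r)})=x_i^{(r+1)}$. With the product $f\circ g=f\,D(g)$ it is a Novikov algebra, and (Dzhumadil'daev–Löfwall) the subalgebra of $(K\{X\},\circ)$ generated by $X$ is the free Novikov algebra $\mathrm{Nov}\langle X\rangle$ on $X$; we identify the two. An element of $\mathrm{Nov}\langle X\rangle$ is a Lie element if it belongs to the Lie subalgebra of $\mathrm{Nov}\langle X\rangle^{(-)}$ generated by $X$. An element is multilinear in the variables indexed by $A\subseteq[n]$ if it is a linear combination of differential monomials $\prod_{i\in A}x_i^{(\alpha_i)}$ with $\alpha_i\ge 0$.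 *)

theory Defs
  imports Complex_Main "HOL-Library.Poly_Mapping"
begin

section \<open>Differential polynomials\<close>

text \<open>The index pair \<open>(i, r)\<close> stands for the differential variable \<open>x\<^sub>i\<^sup>(\<^sup>r\<^sup>)\<close>. A monomial is the
  finitely supported family of its exponents, and a polynomial is the finitely supported family of
  its coefficients.\<close>

type_synonym diff_monom = "(nat \<times> nat) \<Rightarrow>\<^sub>0 nat"
type_synonym 'k diff_poly = "diff_monom \<Rightarrow>\<^sub>0 'k"

definition dvar :: "nat \<Rightarrow> nat \<Rightarrow> 'k::field_char_0 diff_poly" where
  "dvar i r = Poly_Mapping.single (Poly_Mapping.single (i, r) 1) 1"

definition dscale :: "'k::field_char_0 \<Rightarrow> 'k diff_poly \<Rightarrow> 'k diff_poly" where
  "dscale c p = Poly_Mapping.single 0 c * p"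

global_interpretation dpoly: vector_space "dscale :: 'k::field_char_0 \<Rightarrow> 'k diff_poly \<Rightarrow> 'k diff_poly"
  defines dspan = dpoly.span
    and dsubspace = dpoly.subspace
proof
  fix a b :: 'k and x y :: "'k diff_poly"
  show "dscale a (x + y) = dscale a x + dscale a y"
    by (simp add: dscale_def distrib_left)
  show "dscale (a + b) x = dscale a x + dscale b x"
    by (simp add: dscale_def single_add distrib_right)
  show "dscale a (dscale b x) = dscale (a * b) x"
    by (simp add: dscale_def mult.assoc [symmetric] mult_single)
  show "dscale 1 x = x"
    by (simp add: dscale_def)
qed

text \<open>The type \<open>'k diff_poly\<close> has the variables \<open>x\<^sub>i\<^sup>(\<^sup>r\<^sup>)\<close> for all natural numbers \<open>i\<close>; the algebra
  \<open>K{x\<^sub>1, \<dots>, x\<^sub>n}\<close> consists of the polynomials in which only those with \<open>1 \<le> i \<le> n\<close> occur.\<close>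

definition diff_alg :: "nat \<Rightarrow> 'k::field_char_0 diff_poly set" where
  "diff_alg n = {p. \<forall>m\<in>Poly_Mapping.keys p. \<forall>(i, r)\<in>Poly_Mapping.keys m. i \<in> {1..n}}"

text \<open>The derivation is the sum over all \<open>v = (i, r)\<close> of \<open>x\<^sub>i\<^sup>(\<^sup>r\<^sup>+\<^sup>1\<^sup>) \<partial>/\<partial>x\<^sub>i\<^sup>(\<^sup>r\<^sup>)\<close>, spelled out on monomials.\<close>

definition shift_var :: "nat \<times> nat \<Rightarrow> diff_monom \<Rightarrow> diff_monom" where
  "shift_var v m = m - Poly_Mapping.single v 1 + Poly_Mapping.single (fst v, Suc (snd v)) 1"

definition deriv_monom :: "diff_monom \<Rightarrow> 'k::field_char_0 diff_poly" where
  "deriv_monom m = (\<Sum>v\<in>Poly_Mapping.keys m.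
     Poly_Mapping.single (shift_var v m) (of_nat (Poly_Mapping.lookup m v)))"

definition ddiff :: "'k::field_char_0 diff_poly \<Rightarrow> 'k diff_poly" where
  "ddiff p = (\<Sum>m\<in>Poly_Mapping.keys p. dscale (Poly_Mapping.lookup p m) (deriv_monom m))"

lemma ddiff_superset:
  assumes "finite S" "Poly_Mapping.keys p \<subseteq> S"
  shows "ddiff p = (\<Sum>m\<in>S. dscale (Poly_Mapping.lookup p m) (deriv_monom m))"
  unfolding ddiff_def
  by (rule sum.mono_neutral_left) (use assms in \<open>auto simp: in_keys_iff\<close>)

lemma ddiff_add: "ddiff (p + q) = ddiff p + ddiff q"
proof -
  let ?S = "Poly_Mapping.keys p \<union> Poly_Mapping.keys q"
  have "Poly_Mapping.keys (p + q) \<subseteq> ?S"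
    by (rule Poly_Mapping.keys_add)
  then show ?thesis
    by (simp add: ddiff_superset [of ?S] lookup_add dpoly.scale_left_distrib sum.distrib)
qed

lemma ddiff_zero [simp]: "ddiff 0 = 0"
  by (simp add: ddiff_def)

lemma ddiff_single: "ddiff (Poly_Mapping.single m c) = dscale c (deriv_monom m)"
  by (subst ddiff_superset [of "{m}"]) auto

lemma diff_poly_induct [case_names zero add]:
  fixes p :: "'k::field_char_0 diff_poly"
  assumes "P 0" and "\<And>p m c. P p \<Longrightarrow> P (p + Poly_Mapping.single m c)"
  shows "P p"
proof (induction p rule: update_induct)
  case const
  then show ?case by (simp add: assms)
next
  case (update f a b)
  have "Poly_Mapping.update a b f = f + Poly_Mapping.single a b"
    using update(1) by (intro poly_mapping_eqI)
      (auto simp: lookup_update lookup_add lookup_single when_def in_keys_iff)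
  then show ?case using assms update by simp
qed

lemma deriv_monom_superset:
  assumes "finite S" "Poly_Mapping.keys m \<subseteq> S"
  shows "deriv_monom m = (\<Sum>v\<in>S. Poly_Mapping.single (shift_var v m) (of_nat (Poly_Mapping.lookup m v)))"
  unfolding deriv_monom_def
  by (rule sum.mono_neutral_left) (use assms in \<open>auto simp: in_keys_iff\<close>)

lemma shift_var_add:
  assumes "Poly_Mapping.lookup m v \<noteq> 0"
  shows "shift_var v (m + k) = shift_var v m + k"
  using assms unfolding shift_var_def
  by (intro poly_mapping_eqI) (auto simp: lookup_add lookup_minus lookup_single when_def)

lemma deriv_monom_add:
  "deriv_monom (m + k) = (deriv_monom m * Poly_Mapping.single k 1
     + Poly_Mapping.single m 1 * deriv_monom k :: 'k::field_char_0 diff_poly)"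
proof -
  let ?S = "Poly_Mapping.keys m \<union> Poly_Mapping.keys k"
  have *: "Poly_Mapping.keys (m + k) \<subseteq> ?S"
    by (rule Poly_Mapping.keys_add)
  have "Poly_Mapping.single (shift_var v (m + k)) (of_nat (Poly_Mapping.lookup (m + k) v)) =
      (Poly_Mapping.single (shift_var v m) (of_nat (Poly_Mapping.lookup m v)) * Poly_Mapping.single k 1
     + Poly_Mapping.single m 1 * Poly_Mapping.single (shift_var v k) (of_nat (Poly_Mapping.lookup k v))
       :: 'k diff_poly)" for v
  proof -
    have 1: "Poly_Mapping.single (shift_var v m + k) (of_nat (Poly_Mapping.lookup m v) :: 'k)
        = Poly_Mapping.single (shift_var v (m + k)) (of_nat (Poly_Mapping.lookup m v))"
      by (cases "Poly_Mapping.lookup m v = 0") (simp_all add: shift_var_add)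
    have 2: "Poly_Mapping.single (m + shift_var v k) (of_nat (Poly_Mapping.lookup k v) :: 'k)
        = Poly_Mapping.single (shift_var v (m + k)) (of_nat (Poly_Mapping.lookup k v))"
      by (cases "Poly_Mapping.lookup k v = 0")
        (simp_all add: shift_var_add add.commute [of m])
    show ?thesis
      by (simp add: mult_single 1 2 lookup_add single_add)
  qed
  then show ?thesis
    by (simp add: deriv_monom_superset [of ?S] * sum.distrib sum_distrib_left sum_distrib_right)
qed

lemma ddiff_mult_single:
  "ddiff (Poly_Mapping.single m c * Poly_Mapping.single k d)
    = ddiff (Poly_Mapping.single m c) * Poly_Mapping.single k d
      + Poly_Mapping.single m c * ddiff (Poly_Mapping.single k d)"
proof -
  have s: "Poly_Mapping.single m c = dscale c (Poly_Mapping.single m 1)" for m :: diff_monom and c :: 'a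
    by (simp add: dscale_def mult_single)
  have 3: "dscale a x * dscale b y = dscale (a * b) (x * y)" for a b and x y :: "'a diff_poly"
  proof -
    have "dscale a x * dscale b y = (Poly_Mapping.single 0 a * Poly_Mapping.single 0 b) * (x * y)"
      by (simp only: dscale_def ac_simps)
    then show ?thesis by (simp add: mult_single dscale_def)
  qed
  have "ddiff (Poly_Mapping.single m c * Poly_Mapping.single k d) = dscale (c * d) (deriv_monom (m + k))"
    by (simp add: mult_single ddiff_single)
  also have "\<dots> = dscale c (deriv_monom m) * dscale d (Poly_Mapping.single k 1)
      + dscale c (Poly_Mapping.single m 1) * dscale d (deriv_monom k)"
    by (simp only: 3 deriv_monom_add dpoly.scale_right_distrib)
  finally show ?thesis
    by (simp only: ddiff_single s [symmetric])
qed

lemma ddiff_mult: "ddiff (p * q) = ddiff p * q + p * ddiff q"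
proof (induction p rule: diff_poly_induct)
  case zero
  then show ?case by simp
next
  case (add p m c)
  have "ddiff (Poly_Mapping.single m c * q)
      = ddiff (Poly_Mapping.single m c) * q + Poly_Mapping.single m c * ddiff q"
    by (induction q rule: diff_poly_induct)
      (simp_all add: ddiff_add ddiff_mult_single distrib_left)
  with add show ?case
    by (simp add: ddiff_add distrib_left distrib_right)
qed

lemma ddiff_const: "ddiff (Poly_Mapping.single 0 c) = 0"
  by (simp add: ddiff_single deriv_monom_def)

lemma ddiff_dscale: "ddiff (dscale c p) = dscale c (ddiff p)"
  by (simp add: dscale_def ddiff_mult ddiff_const)

lemma ddiff_dvar: "ddiff (dvar i r) = dvar i (Suc r)"
  by (simp add: dvar_def ddiff_single deriv_monom_def shift_var_def)


section \<open>The free Novikov algebra and its Lie elements\<close>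

definition nov_prod :: "'k::field_char_0 diff_poly \<Rightarrow> 'k diff_poly \<Rightarrow> 'k diff_poly"
    (infixl \<open>\<circ>\<^sub>N\<close> 70) where
  "f \<circ>\<^sub>N g = f * ddiff g"

definition nov_bracket :: "'k::field_char_0 diff_poly \<Rightarrow> 'k diff_poly \<Rightarrow> 'k diff_poly" where
  "nov_bracket f g = f \<circ>\<^sub>N g - g \<circ>\<^sub>N f"

lemma ddiff_diff: "ddiff (p - q) = ddiff p - ddiff q"
  by (metis add_diff_cancel_right' diff_add_cancel ddiff_add)

lemma novikov_left_symmetric:
  "(a \<circ>\<^sub>N b) \<circ>\<^sub>N c - a \<circ>\<^sub>N (b \<circ>\<^sub>N c) = (b \<circ>\<^sub>N a) \<circ>\<^sub>N c - b \<circ>\<^sub>N (a \<circ>\<^sub>N c)"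
  by (simp add: nov_prod_def ddiff_mult algebra_simps)

lemma novikov_right_commutative: "(a \<circ>\<^sub>N b) \<circ>\<^sub>N c = (a \<circ>\<^sub>N c) \<circ>\<^sub>N b"
  by (simp add: nov_prod_def algebra_simps)

lemma nov_bracket_jacobi:
  "nov_bracket a (nov_bracket b c) + nov_bracket b (nov_bracket c a) + nov_bracket c (nov_bracket a b) = 0"
  by (simp add: nov_bracket_def nov_prod_def ddiff_mult ddiff_diff algebra_simps)

definition gens :: "nat \<Rightarrow> 'k::field_char_0 diff_poly set" where
  "gens n = (\<lambda>i. dvar i 0) ` {1..n}"

definition novikov_subalgebra :: "'k::field_char_0 diff_poly set \<Rightarrow> bool" where
  "novikov_subalgebra N \<longleftrightarrow> dsubspace N \<and> (\<forall>a\<in>N. \<forall>b\<in>N. a \<circ>\<^sub>N b \<in> N)"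

definition lie_subalgebra :: "'k::field_char_0 diff_poly set \<Rightarrow> bool" where
  "lie_subalgebra L \<longleftrightarrow> dsubspace L \<and> (\<forall>a\<in>L. \<forall>b\<in>L. nov_bracket a b \<in> L)"

definition nov_free :: "nat \<Rightarrow> 'k::field_char_0 diff_poly set" where
  "nov_free n = (\<lambda>N. novikov_subalgebra N \<and> N \<subseteq> diff_alg n) hull gens n"

definition lie_elements :: "nat \<Rightarrow> 'k::field_char_0 diff_poly set" where
  "lie_elements n = (\<lambda>L. lie_subalgebra L \<and> L \<subseteq> nov_free n) hull gens n"

definition multilinear :: "nat set \<Rightarrow> 'k::field_char_0 diff_poly \<Rightarrow> bool" where
  "multilinear A f \<longleftrightarrow> f \<in> dspan (range (\<lambda>\<alpha> :: nat \<Rightarrow> nat. \<Prod>i\<in>A. dvar i (\<alpha> i)))"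

text \<open>The families intersected in the two hulls are nonempty: \<^term>\<open>diff_alg n\<close> is a Novikov
  subalgebra, and \<^term>\<open>nov_free n\<close> is a Lie subalgebra, each containing the generators.\<close>

lemma diff_alg_mult:
  assumes p: "p \<in> diff_alg n" and q: "q \<in> diff_alg n"
  shows "p * q \<in> diff_alg n"
proof -
  have "fst v \<in> {1..n}" if m: "m \<in> Poly_Mapping.keys (p * q)" and v: "v \<in> Poly_Mapping.keys m" for m v
  proof -
    obtain a b where ab: "m = a + b" "a \<in> Poly_Mapping.keys p" "b \<in> Poly_Mapping.keys q"
      using m keys_mult [of p q] by blast
    then have "v \<in> Poly_Mapping.keys a \<or> v \<in> Poly_Mapping.keys b"
      using v Poly_Mapping.keys_add [of a b] by blast
    then show ?thesis
      using p q ab by (fastforce simp: diff_alg_def)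
  qed
  then show ?thesis
    by (auto simp: diff_alg_def split_beta)
qed

lemma dsubspace_diff_alg: "dsubspace (diff_alg n)"
proof (rule dpoly.subspaceI)
  show "0 \<in> diff_alg n" by (simp add: diff_alg_def)
next
  fix x y :: "'a diff_poly"
  assume "x \<in> diff_alg n" "y \<in> diff_alg n"
  then show "x + y \<in> diff_alg n"
    unfolding diff_alg_def using Poly_Mapping.keys_add [of x y] by blast
next
  fix c :: 'a and x :: "'a diff_poly"
  assume x: "x \<in> diff_alg n"
  have "Poly_Mapping.single 0 c \<in> diff_alg n"
    by (simp add: diff_alg_def)
  with x show "dscale c x \<in> diff_alg n"
    unfolding dscale_def by (rule diff_alg_mult [rotated])
qed

lemma ddiff_diff_alg:
  assumes "p \<in> diff_alg n"
  shows "ddiff p \<in> diff_alg n"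
proof -
  have "Poly_Mapping.single (shift_var v m) c \<in> diff_alg n"
    if m: "m \<in> Poly_Mapping.keys p" and v: "v \<in> Poly_Mapping.keys m" for m v and c :: 'a
  proof -
    have m_keys: "fst w \<in> {1..n}" if "w \<in> Poly_Mapping.keys m" for w
      using assms m that by (fastforce simp: diff_alg_def)
    have "fst w \<in> {1..n}" if w: "w \<in> Poly_Mapping.keys (shift_var v m)" for w
    proof (cases "w \<in> Poly_Mapping.keys m")
      case False
      with w have "w = (fst v, Suc (snd v))"
        by (auto simp: shift_var_def in_keys_iff lookup_add lookup_minus lookup_single when_def
            split: if_splits)
      then show ?thesis
        using m_keys [OF v] by simp
    qed (rule m_keys)
    then show ?thesis
      by (auto simp: diff_alg_def split_beta)
  qed
  then show ?thesis
    unfolding ddiff_def deriv_monom_def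
    by (intro dpoly.subspace_sum dpoly.subspace_scale dsubspace_diff_alg)
qed

lemma novikov_subalgebra_diff_alg: "novikov_subalgebra (diff_alg n)"
  by (simp add: novikov_subalgebra_def dsubspace_diff_alg nov_prod_def diff_alg_mult ddiff_diff_alg)

lemma gens_subset_diff_alg: "gens n \<subseteq> diff_alg n"
  by (auto simp: gens_def dvar_def diff_alg_def)

lemma nov_free_properties:
  shows novikov_subalgebra_nov_free: "novikov_subalgebra (nov_free n)"
    and nov_free_subset: "nov_free n \<subseteq> diff_alg n"
    and gens_subset_nov_free: "gens n \<subseteq> nov_free n"
proof -
  show "nov_free n \<subseteq> diff_alg n"
    unfolding nov_free_def
    by (rule hull_minimal) (simp_all add: gens_subset_diff_alg novikov_subalgebra_diff_alg)
  show "gens n \<subseteq> nov_free n"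
    unfolding nov_free_def by (rule hull_subset)
  show "novikov_subalgebra (nov_free n)"
    unfolding nov_free_def hull_def novikov_subalgebra_def
    by (auto intro!: dpoly.subspace_Inter)
qed

lemma lie_subalgebra_nov_free: "lie_subalgebra (nov_free n)"
  using novikov_subalgebra_nov_free [of n]
  by (auto simp: lie_subalgebra_def novikov_subalgebra_def nov_bracket_def intro: dpoly.subspace_diff)

end

theory Submission
  imports Defs "HOL-Library.Product_Lexorder"
begin

text \<open>Let \<open>E\<close> (\<open>lowering\<close>) be the derivation of \<open>K{X}\<close> with \<open>E x\<^sub>i\<^sup>(\<^sup>r\<^sup>) = r (3 - r) / 2 \<cdot> x\<^sub>i\<^sup>(\<^sup>r\<^sup>-\<^sup>1\<^sup>)\<close>,
  and let \<open>H = [E, D]\<close> (\<open>weight_op\<close>),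
  so that \<open>H x\<^sub>i\<^sup>(\<^sup>r\<^sup>) = (1 - r) x\<^sub>i\<^sup>(\<^sup>r\<^sup>)\<close> and \<open>[H, D] = -D\<close>. If \<open>E f = E g = 0\<close>, \<open>H f = f\<close> and \<open>H g = g\<close>, then
  \<open>E (f \<circ> g) = f (D (E g) + H g) = f g\<close>, which is symmetric in \<open>f\<close> and \<open>g\<close>. So \<open>E\<close> annihilates
  all Lie elements, but it does not annihilate \<open>f \<circ> g\<close>, because \<open>K{X}\<close> is a domain.
  Identifying \<open>f\<close> with the vector field \<open>f D\<close>, this says that Lie elements, unlike the Novikov
  product, are covariant under reparametrization; \<open>E\<close> is its infinitesimal form.\<close>

section \<open>Derivations of the differential polynomial ring\<close>

definition derivation :: "('k::field_char_0 diff_poly \<Rightarrow> 'k diff_poly) \<Rightarrow> bool" where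
  "derivation d \<longleftrightarrow> (\<forall>p q. d (p + q) = d p + d q) \<and> (\<forall>p q. d (p * q) = d p * q + p * d q)
    \<and> (\<forall>c. d (Poly_Mapping.single 0 c) = 0)"

lemma derivation_add: "derivation d \<Longrightarrow> d (p + q) = d p + d q"
  and derivation_mult: "derivation d \<Longrightarrow> d (p * q) = d p * q + p * d q"
  and derivation_const: "derivation d \<Longrightarrow> d (Poly_Mapping.single 0 c) = 0"
  by (simp_all add: derivation_def)

lemma derivation_zero: "derivation d \<Longrightarrow> d 0 = 0"
  using derivation_const [of d 0] by simp

lemma derivation_one: "derivation d \<Longrightarrow> d 1 = 0"
  using derivation_const [of d 1] by simp

lemma derivation_diff: "derivation d \<Longrightarrow> d (p - q) = d p - d q"
  using derivation_add [of d "p - q" q] by simp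

lemma derivation_dscale: "derivation d \<Longrightarrow> d (dscale c p) = dscale c (d p)"
  by (simp add: dscale_def derivation_mult derivation_const)

lemma derivation_ddiff: "derivation ddiff"
  by (simp add: derivation_def ddiff_add ddiff_mult ddiff_const)

lemma derivation_uminus: "derivation d \<Longrightarrow> derivation (\<lambda>p. - d p)"
  by (simp add: derivation_def)

lemma derivation_commutator:
  assumes d: "derivation d" and e: "derivation e"
  shows "derivation (\<lambda>p. d (e p) - e (d p))"
  unfolding derivation_def
  by (simp add: derivation_add [OF d] derivation_add [OF e] derivation_mult [OF d]
      derivation_mult [OF e] derivation_const [OF d] derivation_const [OF e]
      derivation_zero [OF d] derivation_zero [OF e] algebra_simps)

text \<open>The variables generate the algebra: the Leibniz rule carries agreement on them to powers
  and monomials, and linearity to all polynomials.\<close>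

lemma derivation_eqI:
  fixes d e :: "'k::field_char_0 diff_poly \<Rightarrow> 'k diff_poly"
  assumes d: "derivation d" and e: "derivation e"
    and eq: "\<And>i r. d (dvar i r) = e (dvar i r)"
  shows "d p = e p"
proof -
  have var: "d (Poly_Mapping.single (Poly_Mapping.single v k) 1)
      = e (Poly_Mapping.single (Poly_Mapping.single v k) 1)" for v :: "nat \<times> nat" and k :: nat
  proof (induction k)
    case 0
    then show ?case by (simp add: derivation_one [OF d] derivation_one [OF e])
  next
    case (Suc k)
    have "Poly_Mapping.single (Poly_Mapping.single v (Suc k)) (1 :: 'k)
        = Poly_Mapping.single (Poly_Mapping.single v k) 1 * dvar (fst v) (snd v)"
      by (simp add: dvar_def mult_single flip: single_add)
    with Suc show ?case
      by (simp add: derivation_mult [OF d] derivation_mult [OF e] eq)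
  qed
  have monom: "d (Poly_Mapping.single m 1) = e (Poly_Mapping.single m 1)" for m
  proof (induction m rule: update_induct)
    case const
    then show ?case by (simp add: derivation_one [OF d] derivation_one [OF e])
  next
    case (update m v k)
    \<comment> \<open>Since \<open>v\<close> does not occur in \<open>m\<close>, the update
      multiplies the monomial by a power of a new variable.\<close>
    have "Poly_Mapping.update v k m = m + Poly_Mapping.single v k"
      using update(1) by (intro poly_mapping_eqI)
        (auto simp: lookup_update lookup_add lookup_single when_def in_keys_iff)
    then have "Poly_Mapping.single (Poly_Mapping.update v k m) (1 :: 'k)
        = Poly_Mapping.single m 1 * Poly_Mapping.single (Poly_Mapping.single v k) 1"
      by (simp add: mult_single)
    with update var show ?case
      by (simp add: derivation_mult [OF d] derivation_mult [OF e])
  qed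
  show ?thesis
  proof (induction p rule: diff_poly_induct)
    case zero
    then show ?case by (simp add: derivation_zero [OF d] derivation_zero [OF e])
  next
    case (add p m c)
    have "Poly_Mapping.single m c = dscale c (Poly_Mapping.single m 1)"
      by (simp add: dscale_def mult_single)
    with add show ?case
      by (simp add: derivation_add [OF d] derivation_add [OF e] derivation_dscale [OF d]
          derivation_dscale [OF e] monom)
  qed
qed

section \<open>Derivations with prescribed values on the variables\<close>

text \<open>Formally the sum over \<open>v\<close> of \<open>u v\<close> times the partial
  derivative by \<open>v\<close>. Each \<open>v\<close> in the support has positive exponent, so the
  truncated subtraction is exact.\<close>

definition der_monom :: "(nat \<times> nat \<Rightarrow> 'k::field_char_0 diff_poly) \<Rightarrow> diff_monom \<Rightarrow> 'k diff_poly" where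
  "der_monom u m = (\<Sum>v\<in>Poly_Mapping.keys m.
     Poly_Mapping.single (m - Poly_Mapping.single v 1) (of_nat (Poly_Mapping.lookup m v)) * u v)"

definition der :: "(nat \<times> nat \<Rightarrow> 'k::field_char_0 diff_poly) \<Rightarrow> 'k diff_poly \<Rightarrow> 'k diff_poly" where
  "der u p = (\<Sum>m\<in>Poly_Mapping.keys p. dscale (Poly_Mapping.lookup p m) (der_monom u m))"

lemma der_superset:
  assumes "finite S" "Poly_Mapping.keys p \<subseteq> S"
  shows "der u p = (\<Sum>m\<in>S. dscale (Poly_Mapping.lookup p m) (der_monom u m))"
  unfolding der_def
  by (rule sum.mono_neutral_left) (use assms in \<open>auto simp: in_keys_iff\<close>)

lemma der_monom_superset:
  assumes "finite S" "Poly_Mapping.keys m \<subseteq> S"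
  shows "der_monom u m = (\<Sum>v\<in>S.
    Poly_Mapping.single (m - Poly_Mapping.single v 1) (of_nat (Poly_Mapping.lookup m v)) * u v)"
  unfolding der_monom_def
  by (rule sum.mono_neutral_left) (use assms in \<open>auto simp: in_keys_iff\<close>)

lemma der_add: "der u (p + q) = der u p + der u q"
proof -
  let ?S = "Poly_Mapping.keys p \<union> Poly_Mapping.keys q"
  have "Poly_Mapping.keys (p + q) \<subseteq> ?S"
    by (rule Poly_Mapping.keys_add)
  then show ?thesis
    by (simp add: der_superset [of ?S] lookup_add dpoly.scale_left_distrib sum.distrib)
qed

lemma der_single: "der u (Poly_Mapping.single m c) = dscale c (der_monom u m)"
  by (subst der_superset [of "{m}"]) auto

lemma der_monom_add:
  "der_monom u (m + k) = (der_monom u m * Poly_Mapping.single k 1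
     + Poly_Mapping.single m 1 * der_monom u k :: 'k::field_char_0 diff_poly)"
proof -
  let ?S = "Poly_Mapping.keys m \<union> Poly_Mapping.keys k"
  let ?t = "\<lambda>m v. Poly_Mapping.single (m - Poly_Mapping.single v 1)
    (of_nat (Poly_Mapping.lookup m v)) :: 'k diff_poly"
  have keys: "Poly_Mapping.keys (m + k) \<subseteq> ?S"
    by (rule Poly_Mapping.keys_add)
  \<comment> \<open>If \<open>v\<close> does not occur in \<open>a\<close>, the exponents may differ
    by truncation, but then both coefficients are 0.\<close>
  have shift: "Poly_Mapping.single (a - Poly_Mapping.single v 1 + b) (of_nat (Poly_Mapping.lookup a v) :: 'k)
      = Poly_Mapping.single (a + b - Poly_Mapping.single v 1) (of_nat (Poly_Mapping.lookup a v))"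
    for a b :: diff_monom and v
  proof (cases "Poly_Mapping.lookup a v = 0")
    case False
    then have "a - Poly_Mapping.single v 1 + b = a + b - Poly_Mapping.single v 1"
      by (intro poly_mapping_eqI) (auto simp: lookup_add lookup_minus lookup_single when_def)
    then show ?thesis by simp
  qed simp
  \<comment> \<open>The Leibniz rule for the partial derivative by \<open>v\<close>.\<close>
  have t: "?t (m + k) v = ?t m v * Poly_Mapping.single k 1 + Poly_Mapping.single m 1 * ?t k v" for v
    using shift [of m v k] shift [of k v m]
    by (simp add: mult_single lookup_add single_add add.commute [of m])
  have "?t (m + k) v * u v
      = (?t m v * u v) * Poly_Mapping.single k 1 + Poly_Mapping.single m 1 * (?t k v * u v)" for v
    unfolding t by (simp add: algebra_simps)
  then show ?thesis
    by (simp add: der_monom_superset [of ?S] keys sum.distrib sum_distrib_left sum_distrib_right)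
qed

lemma der_mult: "der u (p * q) = der u p * q + p * der u q"
proof (induction p rule: diff_poly_induct)
  case zero
  then show ?case by (simp add: der_def)
next
  case (add p m c)
  have "der u (Poly_Mapping.single m c * q)
      = der u (Poly_Mapping.single m c) * q + Poly_Mapping.single m c * der u q"
  proof (induction q rule: diff_poly_induct)
    case zero
    then show ?case by (simp add: der_def)
  next
    case (add q k d)
    have s: "Poly_Mapping.single m c = dscale c (Poly_Mapping.single m 1)" for m :: diff_monom and c :: 'a
      by (simp add: dscale_def mult_single)
    have dscale_mult: "dscale a x * dscale b y = dscale (a * b) (x * y)" for a b and x y :: "'a diff_poly"
    proof -
      have "dscale a x * dscale b y = (Poly_Mapping.single 0 a * Poly_Mapping.single 0 b) * (x * y)"
        by (simp only: dscale_def ac_simps)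
      then show ?thesis by (simp add: mult_single dscale_def)
    qed
    have "der u (Poly_Mapping.single m c * Poly_Mapping.single k d) = dscale (c * d) (der_monom u (m + k))"
      by (simp add: mult_single der_single)
    also have "\<dots> = dscale c (der_monom u m) * dscale d (Poly_Mapping.single k 1)
        + dscale c (Poly_Mapping.single m 1) * dscale d (der_monom u k)"
      by (simp only: dscale_mult der_monom_add dpoly.scale_right_distrib)
    also have "\<dots> = der u (Poly_Mapping.single m c) * Poly_Mapping.single k d
          + Poly_Mapping.single m c * der u (Poly_Mapping.single k d)"
      by (simp only: der_single s [symmetric])
    finally have "der u (Poly_Mapping.single m c * Poly_Mapping.single k d)
        = der u (Poly_Mapping.single m c) * Poly_Mapping.single k d
          + Poly_Mapping.single m c * der u (Poly_Mapping.single k d)" .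
    with add show ?case
      by (simp add: der_add distrib_left)
  qed
  with add show ?case
    by (simp add: der_add distrib_left distrib_right)
qed

lemma derivation_der: "derivation (der u)"
  by (simp add: derivation_def der_add der_mult der_single der_monom_def)

lemma der_dvar: "der u (dvar i r) = u (i, r)"
  by (simp add: dvar_def der_single der_monom_def)

section \<open>The lowering operator and the weight operator\<close>

text \<open>The coefficients c_r solve c_0 = 0 and c_(r+1) - c_r = 1 - r, which gives the commutator
  with \<open>ddiff\<close> the eigenvalue 1 - r. At r = 0 the truncated index \<open>r - 1\<close>
  is harmless because c_0 = 0.\<close>

definition lowering :: "'k::field_char_0 diff_poly \<Rightarrow> 'k diff_poly" where
  "lowering = der (\<lambda>(i, r). dscale (of_nat r * (3 - of_nat r) / 2) (dvar i (r - 1)))"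

text \<open>On a monomial the eigenvalue is the degree minus the total order of the derivatives.
  Defining it as a commutator makes it a derivation at once.\<close>

definition weight_op :: "'k::field_char_0 diff_poly \<Rightarrow> 'k diff_poly" where
  "weight_op p = lowering (ddiff p) - ddiff (lowering p)"

lemma derivation_lowering: "derivation lowering"
  unfolding lowering_def by (rule derivation_der)

lemma derivation_weight_op: "derivation weight_op"
  unfolding weight_op_def [abs_def]
  by (rule derivation_commutator [OF derivation_lowering derivation_ddiff])

lemma lowering_dvar:
  "lowering (dvar i r) = dscale (of_nat r * (3 - of_nat r) / 2) (dvar i (r - 1))"
  by (simp add: lowering_def der_dvar)

lemma weight_op_dvar: "weight_op (dvar i r) = dscale (1 - of_nat r) (dvar i r)"
proof (cases r)
  case 0
  then show ?thesis
    by (simp add: weight_op_def lowering_dvar ddiff_dvar)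
next
  case (Suc s)
  then show ?thesis
    by (simp add: weight_op_def lowering_dvar ddiff_dvar ddiff_dscale field_simps
        flip: dpoly.scale_left_diff_distrib)
qed

text \<open>Differentiation lowers the weight by one. The commutator and \<open>- ddiff\<close> are
  both derivations, so comparing them on variables suffices.\<close>

lemma weight_op_ddiff: "weight_op (ddiff p) = ddiff (weight_op p) - ddiff p"
proof -
  have "weight_op (ddiff p) - ddiff (weight_op p) = - ddiff p"
  proof (rule derivation_eqI [where d = "\<lambda>p. weight_op (ddiff p) - ddiff (weight_op p)"])
    show "weight_op (ddiff (dvar i r)) - ddiff (weight_op (dvar i r)) = - ddiff (dvar i r)" for i r
      by (simp add: weight_op_dvar ddiff_dvar ddiff_dscale ddiff_diff dpoly.scale_left_diff_distrib)
  qed (intro derivation_commutator derivation_uminus derivation_weight_op derivation_ddiff)+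
  then show ?thesis
    by (simp add: algebra_simps)
qed

lemma lowering_nov_prod:
  assumes "lowering f = 0" "lowering g = 0" "weight_op g = g"
  shows "lowering (f \<circ>\<^sub>N g) = f * g"
proof -
  \<comment> \<open>As \<open>lowering g = 0\<close>, only the first term of the commutator
    \<open>weight_op g\<close> survives.\<close>
  have "lowering (ddiff g) = g"
    using assms by (simp add: weight_op_def)
  then show ?thesis
    using assms by (simp add: nov_prod_def derivation_mult [OF derivation_lowering])
qed

text \<open>Weights add under multiplication, and \<open>ddiff g\<close> has weight 1 - 1 =
  0.\<close>

lemma weight_op_nov_prod:
  assumes "weight_op f = f" "weight_op g = g"
  shows "weight_op (f \<circ>\<^sub>N g) = f \<circ>\<^sub>N g"
  using assms by (simp add: nov_prod_def derivation_mult [OF derivation_weight_op] weight_op_ddiff)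

section \<open>Lie elements and the Novikov product\<close>

lemma lie_elements_lowering_weight:
  assumes "f \<in> lie_elements n"
  shows "lowering f = 0" "weight_op f = f"
proof -
  \<comment> \<open>Weight 1 is carried along because \<open>lowering_nov_prod\<close> requires it
    at each bracket.\<close>
  let ?L = "{f \<in> nov_free n. lowering f = 0 \<and> weight_op f = f}"
  have sub: "dsubspace (nov_free n)"
    and closed: "\<And>a b. a \<in> nov_free n \<Longrightarrow> b \<in> nov_free n \<Longrightarrow> nov_bracket a b \<in> nov_free n"
    using lie_subalgebra_nov_free [of n] by (auto simp: lie_subalgebra_def)
  have "dsubspace ?L"
    by (rule dpoly.subspaceI)
      (simp_all add: dpoly.subspace_0 [OF sub] dpoly.subspace_add [OF sub] dpoly.subspace_scale [OF sub]
        derivation_zero derivation_add derivation_dscale derivation_lowering derivation_weight_op)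
  \<comment> \<open>Lowering the bracket gives \<open>a * b - b * a\<close>, which vanishes by
    commutativity.\<close>
  moreover have "nov_bracket a b \<in> ?L" if "a \<in> ?L" "b \<in> ?L" for a b
    using that closed [of a b]
    by (simp add: nov_bracket_def derivation_diff derivation_lowering derivation_weight_op
        lowering_nov_prod weight_op_nov_prod mult.commute)
  ultimately have "lie_subalgebra ?L"
    by (simp only: lie_subalgebra_def) blast
  moreover have "gens n \<subseteq> ?L"
    using gens_subset_nov_free [of n] by (auto simp: gens_def lowering_dvar weight_op_dvar)
  ultimately have "lie_elements n \<subseteq> ?L"
    unfolding lie_elements_def by (intro hull_minimal) auto
  with assms show "lowering f = 0" "weight_op f = f" by auto
qed

theorem mainTheorem5:
  fixes n :: nat and A B :: "nat set" and f g :: "'k::field_char_0 diff_poly"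
  assumes "A \<union> B = {1..n}" and "A \<inter> B = {}" and "A \<noteq> {}" and "B \<noteq> {}"
    and "f \<in> lie_elements n" and "multilinear A f" and "f \<noteq> 0"
    and "g \<in> lie_elements n" and "multilinear B g" and "g \<noteq> 0"
  shows "f \<circ>\<^sub>N g \<notin> lie_elements n"
proof
  assume "f \<circ>\<^sub>N g \<in> lie_elements n"
  then have "lowering (f \<circ>\<^sub>N g) = 0"
    by (rule lie_elements_lowering_weight)
  moreover have "lowering (f \<circ>\<^sub>N g) = f * g"
    using assms by (intro lowering_nov_prod lie_elements_lowering_weight)
  \<comment> \<open>The absence of zero divisors needs a linear order on the index pairs: here the lexicographic one.\<close>
  ultimately show False
    using assms by simp
qed

end
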